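(* Let $N$ be a closed Riemannian spin manifold of odd dimension $n-1$ (with $n=2m$ even), with Dirac operator $\hat D$, let $S^1$ be the unit circle with coordinate $r\in[0,2\pi]$, and let $M=N\times S^1$ with the product metric $ds^2=dl^2+dr^2$, where $dl^2$ is the metric of $N$. Let $f=f(r)$ be a smooth real valued function on $S^1$ (regarded as a function on $M$ constant along $N$) with zero average, $$\int_0^{2\pi}f(t)\,dt=0,$$ written as $f=\tau h$ with $\tau>0$ and $h$ a smooth $2\pi$-periodic function with $\int_0^{2\pi}h(r)\,dr=0$ and $\int_0^{2\pi}|h(r)|^2dr=1/\mathrm{vol}(N)$. Put $\omega(r)=\int_0^r h(t)\,dt$. Suppose that $\hat D$ has a zero mode $\psi_0$ on $N$, i.e. $\psi_0\neq0$ is a smooth spinor on $N$ with $\hat D\psi_0=0$. Then the spinors $$\varphi_1(\hat x,r)=e^{-\tau\omega(r)}\begin{pmatrix}\psi_0(\hat x)\\ \psi_0(\hat x)\end{pmatrix},\qquad \varphi_2(\hat x,r)=e^{\tau\omega(r)}\begin{pmatrix}\psi_0(\hat x)\\ -\psi_0(\hat x)\end{pmatrix}$$ are zero modes of the operator $H_f$ on $M$, $$H_f\varphi_1=H_f\varphi_2=0,$$ with norms $\|\varphi_{1,2}\|^2=A_{1,2}\|\psi_0\|_N^2$, where $$A_{1,2}=2\int_0^{2\pi}\exp[\mp2\tau\omega(r)]\,dr$$ (upper sign for index $1$, lower sign for index $2$).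
   Context: $\hat D=i\hat\gamma^je_{(j)}{}^k\hat\nabla_k$ is the Dirac operator on $N$, acting on spinors of rank $2^{m-1}$, where $\hat\gamma_j$, $j=1,\dots,n-1$, are Hermitian matrices with $\hat\gamma_i\hat\gamma_j+\hat\gamma_j\hat\gamma_i=2\delta_{ij}\hat I$, $e_{(j)}$ is an orthonormal frame on $N$, and $\hat\nabla$ is the spin connection of $N$. Spinors on $M=N\times S^1$ are pairs $\varphi=(\varphi_+,\varphi_-)$ of $r$-dependent spinors on $N$ that are $2\pi$-periodic in $r$. The Dirac matrices on $M$ are $\gamma_j=\begin{pmatrix}0&-i\hat\gamma_j\\ i\hat\gamma_j&0\end{pmatrix}$ for $j=1,\dots,n-1$ and $\gamma_n=\begin{pmatrix}0&\hat I\\ \hat I&0\end{pmatrix}$, and the Dirac operator on $M$ is $$D=\begin{pmatrix}0&-i\hat D+i\hat I\partial_r\\ i\hat D+i\hat I\partial_r&0\end{pmatrix}.$$ The deformed Dirac operator is $D_f=D+ifI$, with adjoint $D_f^*=D-ifI$, and the Hamiltonian is $H_f=D_f^*D_f=I[\hat D^2-\partial_r^2+f^2(r)]-\gamma_nf'(r)$. $\|\cdot\|$ is the $L^2$ norm on $M$ (with $\|\varphi\|^2=\int_N d\mathrm{vol}_N\int_0^{2\pi}dr\,(|\varphi_+|^2+|\varphi_-|^2)$) and $\|\cdot\|_N$ the $L^2$ norm on $N$. *)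

theory Defs
  imports "HOL-Analysis.Analysis"
begin

section \<open>Smooth functions\<close>

text \<open>
  Only used on open sets \<open>S\<close>: all iterated directional derivatives exist and are
  continuous on \<open>S\<close>.
\<close>

primrec Ck_on :: "nat \<Rightarrow> 'a::real_normed_vector set \<Rightarrow> ('a \<Rightarrow> 'b::real_normed_vector) \<Rightarrow> bool" where
  "Ck_on 0 S f \<longleftrightarrow> continuous_on S f"
| "Ck_on (Suc k) S f \<longleftrightarrow> (\<forall>x\<in>S. f differentiable (at x)) \<and>
     (\<forall>v. Ck_on k S (\<lambda>x. frechet_derivative f (at x) v))"

definition smooth_on :: "'a::real_normed_vector set \<Rightarrow> ('a \<Rightarrow> 'b::real_normed_vector) \<Rightarrow> bool" where
  "smooth_on S f \<longleftrightarrow> (\<forall>k. Ck_on k S f)"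

text \<open>Smooth functions on the unit circle, as \<open>2\<pi>\<close>-periodic smooth functions of \<open>r\<close>.\<close>

definition smooth_circle_fun :: "(real \<Rightarrow> real) \<Rightarrow> bool" where
  "smooth_circle_fun f \<longleftrightarrow> smooth_on UNIV f \<and> (\<forall>r. f (r + 2 * pi) = f r)"

definition partial :: "'d \<Rightarrow> (real^'d \<Rightarrow> 'b) \<Rightarrow> real^'d \<Rightarrow> 'b::real_normed_vector" where
  "partial k F x = frechet_derivative F (at x) (axis k 1)"

section \<open>Closed Riemannian spin manifolds\<close>

text \<open>
  A Riemannian spin manifold is given by local data over an atlas whose charts (\<open>i\<close>
  ranging over \<open>chart_ix\<close>) also trivialise the bundle of oriented orthonormal frames;
  every atlas of a spin manifold can be refined to such an atlas. Here \<open>'d\<close> indexes both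
  the coordinates and the members of a frame, and \<open>'s\<close> indexes the components of a spinor:

  \<open>patch N i\<close> is the domain of the chart \<open>coord N i\<close>;

  \<open>gmat N i x $ k $ l\<close> is the metric component \<open>g\<^sub>k\<^sub>l\<close> at the point with coordinates \<open>x\<close>;

  \<open>frame N i x $ j $ k\<close> is the \<open>k\<close>-th coordinate component of the frame vector \<open>e\<^sub>(\<^sub>j\<^sub>)\<close>;

  \<open>clif N j\<close> are the Dirac matrices, the same constant matrices in all charts;

  \<open>lift N b a p\<close> is the spin lift of the change of frame from chart \<open>a\<close> to chart \<open>b\<close>.
\<close>

record ('i, 'p, 'd, 's) spin_data =
  top_sp :: "'p topology"
  chart_ix :: "'i set"
  patch :: "'i \<Rightarrow> 'p set"
  coord :: "'i \<Rightarrow> 'p \<Rightarrow> real^'d::finite"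
  gmat :: "'i \<Rightarrow> real^'d \<Rightarrow> real^'d^'d"
  frame :: "'i \<Rightarrow> real^'d \<Rightarrow> real^'d^'d"
  clif :: "'d \<Rightarrow> complex^'s^'s::finite"
  lift :: "'i \<Rightarrow> 'i \<Rightarrow> 'p \<Rightarrow> complex^'s^'s"

definition coord_dom :: "('i,'p,'d::finite,'s::finite) spin_data \<Rightarrow> 'i \<Rightarrow> (real^'d) set" where
  "coord_dom N i = coord N i ` patch N i"

definition chart_inv :: "('i,'p,'d::finite,'s::finite) spin_data \<Rightarrow> 'i \<Rightarrow> real^'d \<Rightarrow> 'p" where
  "chart_inv N i = inv_into (patch N i) (coord N i)"

definition overlap :: "('i,'p,'d::finite,'s::finite) spin_data \<Rightarrow> 'i \<Rightarrow> 'i \<Rightarrow> (real^'d) set" where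
  "overlap N a b = coord N a ` (patch N a \<inter> patch N b)"

definition transition :: "('i,'p,'d::finite,'s::finite) spin_data \<Rightarrow> 'i \<Rightarrow> 'i \<Rightarrow> real^'d \<Rightarrow> real^'d" where
  "transition N a b = coord N b \<circ> chart_inv N a"

definition closed_manifold :: "('i,'p,'d::finite,'s::finite) spin_data \<Rightarrow> bool" where
  "closed_manifold N \<longleftrightarrow>
     compact_space (top_sp N) \<and> Hausdorff_space (top_sp N) \<and>
     topspace (top_sp N) = (\<Union>i\<in>chart_ix N. patch N i) \<and>
     (\<forall>i\<in>chart_ix N. openin (top_sp N) (patch N i) \<and> open (coord_dom N i) \<and>
        homeomorphic_map (subtopology (top_sp N) (patch N i)) (top_of_set (coord_dom N i)) (coord N i)) \<and>
     (\<forall>a\<in>chart_ix N. \<forall>b\<in>chart_ix N. smooth_on (overlap N a b) (transition N a b))"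

definition jacobian :: "('i,'p,'d::finite,'s::finite) spin_data \<Rightarrow> 'i \<Rightarrow> 'i \<Rightarrow> 'p \<Rightarrow> real^'d^'d" where
  "jacobian N a b p = matrix (frechet_derivative (transition N a b) (at (coord N a p)))"

definition riemannian_metric :: "('i,'p,'d::finite,'s::finite) spin_data \<Rightarrow> bool" where
  "riemannian_metric N \<longleftrightarrow>
     (\<forall>i\<in>chart_ix N. smooth_on (coord_dom N i) (gmat N i) \<and>
        (\<forall>x\<in>coord_dom N i. transpose (gmat N i x) = gmat N i x \<and>
            (\<forall>v. v \<noteq> 0 \<longrightarrow> v \<bullet> (gmat N i x *v v) > 0))) \<and>
     (\<forall>a\<in>chart_ix N. \<forall>b\<in>chart_ix N. \<forall>p\<in>patch N a \<inter> patch N b.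
        gmat N a (coord N a p) =
          transpose (jacobian N a b p) ** gmat N b (coord N b p) ** jacobian N a b p)"

text \<open>
  The matrix taking frame components of tangent vectors at \<open>p\<close> in chart \<open>a\<close> to those in
  chart \<open>b\<close>: its \<open>(i,j)\<close> entry is the metric product of the \<open>i\<close>-th frame vector of \<open>b\<close>
  with the \<open>j\<close>-th frame vector of \<open>a\<close>.
\<close>

definition frame_change :: "('i,'p,'d::finite,'s::finite) spin_data \<Rightarrow> 'i \<Rightarrow> 'i \<Rightarrow> 'p \<Rightarrow> real^'d^'d" where
  "frame_change N b a p =
     frame N b (coord N b p) ** gmat N b (coord N b p) ** jacobian N a b p
       ** transpose (frame N a (coord N a p))"

definition oriented_orthonormal_frames :: "('i,'p,'d::finite,'s::finite) spin_data \<Rightarrow> bool" where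
  "oriented_orthonormal_frames N \<longleftrightarrow>
     (\<forall>i\<in>chart_ix N. smooth_on (coord_dom N i) (frame N i) \<and>
        (\<forall>x\<in>coord_dom N i. frame N i x ** gmat N i x ** transpose (frame N i x) = mat 1)) \<and>
     (\<forall>a\<in>chart_ix N. \<forall>b\<in>chart_ix N. \<forall>p\<in>patch N a \<inter> patch N b. det (frame_change N b a p) = 1)"

definition dirac_matrices :: "('d \<Rightarrow> complex^'s^'s::finite) \<Rightarrow> bool" where
  "dirac_matrices \<gamma> \<longleftrightarrow>
     (\<forall>j a b. \<gamma> j $ a $ b = cnj (\<gamma> j $ b $ a)) \<and>
     (\<forall>i j. \<gamma> i ** \<gamma> j + \<gamma> j ** \<gamma> i = (if i = j then 2 else 0) *\<^sub>R mat 1)"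

definition clifford :: "('d::finite \<Rightarrow> complex^'s^'s::finite) \<Rightarrow> real^'d \<Rightarrow> complex^'s^'s" where
  "clifford \<gamma> v = (\<Sum>j\<in>UNIV. v $ j *\<^sub>R \<gamma> j)"

text \<open>
  The group \<open>Spin(d)\<close> in its spinor representation: the products of evenly many unit vectors
  of the Clifford algebra. In odd dimension this representation is faithful.
\<close>

inductive_set spin_group :: "('d::finite \<Rightarrow> complex^'s^'s::finite) \<Rightarrow> (complex^'s^'s) set"
  for \<gamma> where
  one: "mat 1 \<in> spin_group \<gamma>"
| mult: "norm v = 1 \<Longrightarrow> norm w = 1 \<Longrightarrow> S \<in> spin_group \<gamma> \<Longrightarrow>
           clifford \<gamma> v ** clifford \<gamma> w ** S \<in> spin_group \<gamma>"

text \<open>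
  A spin structure: a cocycle of \<open>Spin(d)\<close>-valued transition functions that covers the
  \<open>SO(d)\<close>-valued cocycle \<open>frame_change\<close>.
\<close>

definition spin_structure :: "('i,'p,'d::finite,'s::finite) spin_data \<Rightarrow> bool" where
  "spin_structure N \<longleftrightarrow>
     dirac_matrices (clif N) \<and>
     (\<forall>a\<in>chart_ix N. \<forall>b\<in>chart_ix N.
        smooth_on (overlap N a b) (\<lambda>x. lift N b a (chart_inv N a x)) \<and>
        (\<forall>p\<in>patch N a \<inter> patch N b.
           lift N b a p \<in> spin_group (clif N) \<and>
           (\<forall>j. lift N b a p ** clif N j =
              (\<Sum>i\<in>UNIV. frame_change N b a p $ i $ j *\<^sub>R clif N i) ** lift N b a p))) \<and>
     (\<forall>a\<in>chart_ix N. \<forall>p\<in>patch N a. lift N a a p = mat 1) \<and>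
     (\<forall>a\<in>chart_ix N. \<forall>b\<in>chart_ix N. \<forall>c\<in>chart_ix N. \<forall>p\<in>patch N a \<inter> patch N b \<inter> patch N c.
        lift N c b p ** lift N b a p = lift N c a p)"

definition closed_riemannian_spin_manifold :: "('i,'p,'d::finite,'s::finite) spin_data \<Rightarrow> bool" where
  "closed_riemannian_spin_manifold N \<longleftrightarrow>
     closed_manifold N \<and> riemannian_metric N \<and> oriented_orthonormal_frames N \<and> spin_structure N"

text \<open>The Riemannian volume measure, the Borel measure with density \<open>\<surd>(det g)\<close> in every chart;
  it exists and is unique by the change of variables formula and compactness.\<close>

definition is_volume_measure :: "('i,'p,'d::finite,'s::finite) spin_data \<Rightarrow> 'p measure \<Rightarrow> bool" where
  "is_volume_measure N \<mu> \<longleftrightarrow>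
     space \<mu> = topspace (top_sp N) \<and>
     sets \<mu> = sigma_sets (topspace (top_sp N)) {U. openin (top_sp N) U} \<and>
     (\<forall>i\<in>chart_ix N. \<forall>A\<in>sets \<mu>. A \<subseteq> patch N i \<longrightarrow>
        emeasure \<mu> A = (\<integral>\<^sup>+x\<in>coord N i ` A. ennreal (sqrt (det (gmat N i x))) \<partial>lborel))"

definition dvol :: "('i,'p,'d::finite,'s::finite) spin_data \<Rightarrow> 'p measure" where
  "dvol N = (THE \<mu>. is_volume_measure N \<mu>)"

definition vol :: "('i,'p,'d::finite,'s::finite) spin_data \<Rightarrow> real" where
  "vol N = measure (dvol N) (topspace (top_sp N))"

section \<open>Spinors and the Dirac operator on \<open>N\<close>\<close>

text \<open>
  A spinor field is given by its local representatives as functions of the coordinates;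
  values outside \<open>chart_ix N\<close> and \<open>coord_dom N i\<close> are irrelevant.
\<close>

type_synonym ('i, 'd, 's) spinor = "'i \<Rightarrow> real^'d \<Rightarrow> complex^'s"

definition compatible_spinor ::
    "('i,'p,'d::finite,'s::finite) spin_data \<Rightarrow> ('i,'d,'s) spinor \<Rightarrow> bool" where
  "compatible_spinor N \<psi> \<longleftrightarrow>
     (\<forall>a\<in>chart_ix N. \<forall>b\<in>chart_ix N. \<forall>p\<in>patch N a \<inter> patch N b.
        \<psi> b (coord N b p) = lift N b a p *v \<psi> a (coord N a p))"

definition smooth_spinor ::
    "('i,'p,'d::finite,'s::finite) spin_data \<Rightarrow> ('i,'d,'s) spinor \<Rightarrow> bool" where
  "smooth_spinor N \<psi> \<longleftrightarrow>
     compatible_spinor N \<psi> \<and> (\<forall>i\<in>chart_ix N. smooth_on (coord_dom N i) (\<psi> i))"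

definition zero_spinor ::
    "('i,'p,'d::finite,'s::finite) spin_data \<Rightarrow> ('i,'d,'s) spinor \<Rightarrow> bool" where
  "zero_spinor N \<psi> \<longleftrightarrow> (\<forall>i\<in>chart_ix N. \<forall>x\<in>coord_dom N i. \<psi> i x = 0)"

text \<open>The Christoffel symbol with upper index \<open>l\<close> and lower indices \<open>j\<close>, \<open>k\<close>.\<close>

definition christoffel ::
    "('i,'p,'d::finite,'s::finite) spin_data \<Rightarrow> 'i \<Rightarrow> real^'d \<Rightarrow> 'd \<Rightarrow> 'd \<Rightarrow> 'd \<Rightarrow> real" where
  "christoffel N c x l j k =
     (\<Sum>a\<in>UNIV. matrix_inv (gmat N c x) $ l $ a *
        (partial j (\<lambda>y. gmat N c y $ a $ k) x + partial k (\<lambda>y. gmat N c y $ a $ j) x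
          - partial a (\<lambda>y. gmat N c y $ j $ k) x)) / 2"

text \<open>
  The connection coefficients of the Levi-Civita connection in the frame: the metric product
  of \<open>e\<^sub>(\<^sub>i\<^sub>)\<close> with the covariant derivative of \<open>e\<^sub>(\<^sub>j\<^sub>)\<close> along the \<open>k\<close>-th coordinate.
\<close>

definition frame_connection ::
    "('i,'p,'d::finite,'s::finite) spin_data \<Rightarrow> 'i \<Rightarrow> real^'d \<Rightarrow> 'd \<Rightarrow> 'd \<Rightarrow> 'd \<Rightarrow> real" where
  "frame_connection N c x k i j =
     (\<Sum>a\<in>UNIV. (gmat N c x *v (frame N c x $ i)) $ a *
        (partial k (\<lambda>y. frame N c y $ j $ a) x
          + (\<Sum>b\<in>UNIV. christoffel N c x a k b * frame N c x $ j $ b)))"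

text \<open>
  The factor \<open>1/4\<close> and the index order make Clifford multiplication parallel, given that
  Clifford generators square to \<open>+1\<close>.
\<close>

definition spin_nabla ::
    "('i,'p,'d::finite,'s::finite) spin_data \<Rightarrow> 'd \<Rightarrow> ('i,'d,'s) spinor \<Rightarrow> ('i,'d,'s) spinor" where
  "spin_nabla N k \<psi> = (\<lambda>c x. partial k (\<psi> c) x +
     (1/4) *\<^sub>R (\<Sum>i\<in>UNIV. \<Sum>j\<in>UNIV.
        frame_connection N c x k i j *\<^sub>R (clif N i *v (clif N j *v \<psi> c x))))"

definition dirac ::
    "('i,'p,'d::finite,'s::finite) spin_data \<Rightarrow> ('i,'d,'s) spinor \<Rightarrow> ('i,'d,'s) spinor" where
  "dirac N \<psi> = (\<lambda>c x. \<i> *s (\<Sum>j\<in>UNIV. clif N j *v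
     (\<Sum>k\<in>UNIV. frame N c x $ j $ k *\<^sub>R spin_nabla N k \<psi> c x)))"

text \<open>Pointwise norm; independent of the chart, because the elements of \<open>spin_group\<close> are unitary.\<close>

definition pnorm ::
    "('i,'p,'d::finite,'s::finite) spin_data \<Rightarrow> ('i,'d,'s) spinor \<Rightarrow> 'p \<Rightarrow> real" where
  "pnorm N \<psi> p = (let c = (SOME c. c \<in> chart_ix N \<and> p \<in> patch N c) in norm (\<psi> c (coord N c p)))"

definition L2norm ::
    "('i,'p,'d::finite,'s::finite) spin_data \<Rightarrow> ('i,'d,'s) spinor \<Rightarrow> real" where
  "L2norm N \<psi> = sqrt (LINT p|dvol N. (pnorm N \<psi> p)\<^sup>2)"

definition dirac_zero_mode ::
    "('i,'p,'d::finite,'s::finite) spin_data \<Rightarrow> ('i,'d,'s) spinor \<Rightarrow> bool" where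
  "dirac_zero_mode N \<psi> \<longleftrightarrow>
     smooth_spinor N \<psi> \<and> \<not> zero_spinor N \<psi> \<and> zero_spinor N (dirac N \<psi>)"

section \<open>Spinors and Dirac operators on \<open>M = N \<times> S\<^sup>1\<close>\<close>

type_synonym ('i, 'd, 's) rspinor = "real \<Rightarrow> ('i, 'd, 's) spinor"
type_synonym ('i, 'd, 's) spinorM = "('i, 'd, 's) rspinor \<times> ('i, 'd, 's) rspinor"

definition smooth_rspinor ::
    "('i,'p,'d::finite,'s::finite) spin_data \<Rightarrow> ('i,'d,'s) rspinor \<Rightarrow> bool" where
  "smooth_rspinor N \<eta> \<longleftrightarrow>
     (\<forall>r. compatible_spinor N (\<eta> r)) \<and>
     (\<forall>i\<in>chart_ix N. smooth_on (coord_dom N i \<times> UNIV) (\<lambda>(x, r). \<eta> r i x)) \<and>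
     (\<forall>i\<in>chart_ix N. \<forall>x\<in>coord_dom N i. \<forall>r. \<eta> (r + 2 * pi) i x = \<eta> r i x)"

definition smooth_spinorM ::
    "('i,'p,'d::finite,'s::finite) spin_data \<Rightarrow> ('i,'d,'s) spinorM \<Rightarrow> bool" where
  "smooth_spinorM N \<phi> \<longleftrightarrow> smooth_rspinor N (fst \<phi>) \<and> smooth_rspinor N (snd \<phi>)"

definition zero_spinorM ::
    "('i,'p,'d::finite,'s::finite) spin_data \<Rightarrow> ('i,'d,'s) spinorM \<Rightarrow> bool" where
  "zero_spinorM N \<phi> \<longleftrightarrow> (\<forall>r. zero_spinor N (fst \<phi> r) \<and> zero_spinor N (snd \<phi> r))"

definition dr :: "('i,'d,'s) rspinor \<Rightarrow> ('i,'d::finite,'s::finite) rspinor" where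
  "dr \<eta> = (\<lambda>r i x. vector_derivative (\<lambda>t. \<eta> t i x) (at r))"

definition diracM ::
    "('i,'p,'d::finite,'s::finite) spin_data \<Rightarrow> ('i,'d,'s) spinorM \<Rightarrow> ('i,'d,'s) spinorM" where
  "diracM N \<phi> =
     ((\<lambda>r i x. (- \<i>) *s dirac N (snd \<phi> r) i x + \<i> *s dr (snd \<phi>) r i x),
      (\<lambda>r i x. \<i> *s dirac N (fst \<phi> r) i x + \<i> *s dr (fst \<phi>) r i x))"

definition dirac_deformed ::
    "('i,'p,'d::finite,'s::finite) spin_data \<Rightarrow> (real \<Rightarrow> real) \<Rightarrow> ('i,'d,'s) spinorM \<Rightarrow> ('i,'d,'s) spinorM" where
  "dirac_deformed N f \<phi> =
     ((\<lambda>r i x. fst (diracM N \<phi>) r i x + (\<i> * complex_of_real (f r)) *s fst \<phi> r i x),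
      (\<lambda>r i x. snd (diracM N \<phi>) r i x + (\<i> * complex_of_real (f r)) *s snd \<phi> r i x))"

definition dirac_deformed_adj ::
    "('i,'p,'d::finite,'s::finite) spin_data \<Rightarrow> (real \<Rightarrow> real) \<Rightarrow> ('i,'d,'s) spinorM \<Rightarrow> ('i,'d,'s) spinorM" where
  "dirac_deformed_adj N f \<phi> =
     ((\<lambda>r i x. fst (diracM N \<phi>) r i x - (\<i> * complex_of_real (f r)) *s fst \<phi> r i x),
      (\<lambda>r i x. snd (diracM N \<phi>) r i x - (\<i> * complex_of_real (f r)) *s snd \<phi> r i x))"

definition hamiltonian ::
    "('i,'p,'d::finite,'s::finite) spin_data \<Rightarrow> (real \<Rightarrow> real) \<Rightarrow> ('i,'d,'s) spinorM \<Rightarrow> ('i,'d,'s) spinorM" where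
  "hamiltonian N f \<phi> = dirac_deformed_adj N f (dirac_deformed N f \<phi>)"

definition hamiltonian_zero_mode ::
    "('i,'p,'d::finite,'s::finite) spin_data \<Rightarrow> (real \<Rightarrow> real) \<Rightarrow> ('i,'d,'s) spinorM \<Rightarrow> bool" where
  "hamiltonian_zero_mode N f \<phi> \<longleftrightarrow>
     smooth_spinorM N \<phi> \<and> \<not> zero_spinorM N \<phi> \<and> zero_spinorM N (hamiltonian N f \<phi>)"

definition L2normM ::
    "('i,'p,'d::finite,'s::finite) spin_data \<Rightarrow> ('i,'d,'s) spinorM \<Rightarrow> real" where
  "L2normM N \<phi> =
     sqrt (LINT p|dvol N. (LBINT r=0..2 * pi. (pnorm N (fst \<phi> r) p)\<^sup>2 + (pnorm N (snd \<phi> r) p)\<^sup>2))"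

end

theory Submission
  imports Defs
begin

text \<open>
  Since \<open>\<omega>' = h\<close> and \<open>\<psi>\<^sub>0\<close> is annihilated by the Dirac operator of \<open>N\<close>, both spinors
  satisfy the first-order equation \<open>D\<^sub>f \<phi> = 0\<close>: the radial derivative of the exponential cancels
  the term \<open>\<i> f \<phi>\<close>. Hence \<open>H\<^sub>f \<phi> = D\<^sub>f\<^sup>* D\<^sub>f \<phi> = 0\<close>. The zero average of \<open>h\<close> makes \<open>\<omega>\<close>,
  and so both spinors, periodic. The pointwise norms factor into a function of \<open>r\<close> and
  the pointwise norm of \<open>\<psi>\<^sub>0\<close>, so the norms follow by pulling constants out of integrals.
\<close>

section \<open>Closure properties of smooth functions\<close>

lemma frechet_derivativeI: "(f has_derivative f') (at x) \<Longrightarrow> frechet_derivative f (at x) = f'"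
  by (rule frechet_derivative_at[symmetric])

text \<open>The base case is that differentiability implies continuity; it propagates through the
  iterated derivatives. The product rule needs this to lower the factor left
  undifferentiated.\<close>

lemma Ck_on_Suc_lower: "Ck_on (Suc k) S f \<Longrightarrow> Ck_on k S f"
proof (induction k arbitrary: f)
  case 0
  then show ?case
    by (auto intro!: continuous_at_imp_continuous_on differentiable_imp_continuous_within)
next
  case (Suc k)
  from Suc.prems have d: "\<forall>x\<in>S. f differentiable (at x)"
    and c: "\<And>v. Ck_on (Suc k) S (\<lambda>x. frechet_derivative f (at x) v)"
    by simp_all
  show ?case
    unfolding Ck_on.simps(2)[of k] using d Suc.IH[OF c] by blast
qed

text \<open>On an open set, agreement on \<open>S\<close> is agreement near each point of
  \<open>S\<close>, so the derivatives there coincide as well and the induction can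
  continue.\<close>

lemma Ck_on_cong:
  assumes "open S" "\<And>x. x \<in> S \<Longrightarrow> f x = g x" "Ck_on k S f"
  shows "Ck_on k S g"
  using assms
proof (induction k arbitrary: f g)
  case 0
  then show ?case by (simp cong: continuous_on_cong)
next
  case (Suc k)
  have D: "(g has_derivative frechet_derivative f (at x)) (at x)" if "x \<in> S" for x
  proof (rule has_derivative_transform_within_open[OF _ \<open>open S\<close> that])
    show "(f has_derivative frechet_derivative f (at x)) (at x)"
      using Suc.prems(3) that frechet_derivative_works[of f "at x"] by auto
  qed (use Suc.prems in auto)
  have "Ck_on k S (\<lambda>x. frechet_derivative g (at x) v)" for v
    by (rule Suc.IH[of "\<lambda>x. frechet_derivative f (at x) v"])
      (use Suc.prems frechet_derivativeI[OF D] in auto)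
  then show ?case using D by (auto simp: differentiable_def)
qed

text \<open>Allows an explicit formula for the derivative in place of
  \<open>frechet_derivative\<close>. The two need only agree on \<open>S\<close>, which
  \<open>Ck_on_cong\<close> accommodates.\<close>

lemma Ck_on_SucI:
  assumes "open S" "\<And>x. x \<in> S \<Longrightarrow> (f has_derivative f' x) (at x)"
    and "\<And>v. Ck_on k S (\<lambda>x. f' x v)"
  shows "Ck_on (Suc k) S f"
proof -
  have "Ck_on k S (\<lambda>x. frechet_derivative f (at x) v)" for v
    by (rule Ck_on_cong[OF assms(1) _ assms(3)[of v]])
      (simp add: frechet_derivativeI[OF assms(2)])
  then show ?thesis using assms(2) by (auto simp: differentiable_def)
qed

lemma Ck_on_SucD:
  assumes "Ck_on (Suc k) S f"
  shows "x \<in> S \<Longrightarrow> (f has_derivative frechet_derivative f (at x)) (at x)"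
    and "Ck_on k S (\<lambda>x. frechet_derivative f (at x) v)"
  using assms frechet_derivative_works[of f "at x"] by auto

lemma Ck_on_add:
  assumes "open S" "Ck_on k S f" "Ck_on k S g"
  shows "Ck_on k S (\<lambda>x. f x + g x)"
  using assms
proof (induction k arbitrary: f g)
  case 0
  then show ?case by (auto intro: continuous_intros)
next
  case (Suc k)
  show ?case
    by (rule Ck_on_SucI[OF \<open>open S\<close> has_derivative_add
          [OF Ck_on_SucD(1)[OF Suc.prems(2)] Ck_on_SucD(1)[OF Suc.prems(3)]]])
      (auto intro!: Suc.IH Suc.prems(1) Ck_on_SucD(2)[OF Suc.prems(2)]
        Ck_on_SucD(2)[OF Suc.prems(3)])
qed

lemma Ck_on_scaleR:
  assumes "open S" "Ck_on k S a" "Ck_on k S f"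
  shows "Ck_on k S (\<lambda>x. a x *\<^sub>R f x)"
  using assms
proof (induction k arbitrary: a f)
  case 0
  then show ?case by (auto intro: continuous_intros)
next
  case (Suc k)
  show ?case
    by (rule Ck_on_SucI[OF \<open>open S\<close> has_derivative_scaleR
          [OF Ck_on_SucD(1)[OF Suc.prems(2)] Ck_on_SucD(1)[OF Suc.prems(3)]]])
      (auto intro!: Suc.IH Ck_on_add Suc.prems(1) Ck_on_SucD(2)[OF Suc.prems(2)]
        Ck_on_SucD(2)[OF Suc.prems(3)] Ck_on_Suc_lower[OF Suc.prems(2)]
        Ck_on_Suc_lower[OF Suc.prems(3)])
qed

lemma Ck_on_const: "Ck_on k S (\<lambda>x. c)"
  by (induction k arbitrary: c) simp_all

text \<open>For linear \<open>L\<close> the chain rule gives the derivative of \<open>g\<close> at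
  \<open>L x\<close> in the direction \<open>L v\<close>. This direction does not depend on
  \<open>x\<close>, so the induction hypothesis applies to it directly.\<close>

lemma Ck_on_compose_linear:
  assumes "bounded_linear L" "open T" "L ` T \<subseteq> S" "Ck_on k S g"
  shows "Ck_on k T (\<lambda>x. g (L x))"
  using assms
proof (induction k arbitrary: g)
  case 0
  then show ?case
    using continuous_on_compose2[of S g T L] linear_continuous_on by auto
next
  case (Suc k)
  show ?case
  proof (rule Ck_on_SucI[OF \<open>open T\<close>])
    show "((\<lambda>x. g (L x)) has_derivative (\<lambda>v. frechet_derivative g (at (L x)) (L v))) (at x)"
      if "x \<in> T" for x
      by (rule has_derivative_compose[OF bounded_linear_imp_has_derivative[OF \<open>bounded_linear L\<close>]])
        (use that Suc.prems Ck_on_SucD(1)[OF Suc.prems(4)] in auto)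
    show "Ck_on k T (\<lambda>x. frechet_derivative g (at (L x)) (L v))" for v
      by (rule Suc.IH[OF Suc.prems(1-3) Ck_on_SucD(2)[OF Suc.prems(4)]])
  qed
qed

lemma smooth_on_has_derivative:
  assumes "smooth_on S f" "x \<in> S"
  shows "(f has_derivative frechet_derivative f (at x)) (at x)"
  using Ck_on_SucD(1)[of 0 S f x] assms by (auto simp: smooth_on_def simp del: Ck_on.simps)

lemma smooth_on_imp_continuous_on: "smooth_on S f \<Longrightarrow> continuous_on S f"
  by (metis smooth_on_def Ck_on.simps(1))

text \<open>Both factors are pullbacks along the linear projections \<open>fst\<close> and
  \<open>snd\<close>, so the linear chain rule and the product rule suffice.\<close>

lemma smooth_on_scaleR_prod:
  assumes "open S" "smooth_on UNIV a" "smooth_on S f"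
  shows "smooth_on (S \<times> UNIV) (\<lambda>(x, r). a r *\<^sub>R f x)"
proof -
  have "Ck_on k (S \<times> UNIV) (\<lambda>z. a (snd z) *\<^sub>R f (fst z))" for k
    using assms unfolding smooth_on_def
    by (intro Ck_on_scaleR Ck_on_compose_linear[OF bounded_linear_snd, where S = UNIV]
        Ck_on_compose_linear[OF bounded_linear_fst, where S = S] open_Times) auto
  then show ?thesis by (simp add: smooth_on_def case_prod_beta')
qed

text \<open>A bootstrap: the derivative is \<open>c * h r\<close> times the function itself, so
  regularity of order \<open>k\<close> yields order \<open>k + 1\<close>.\<close>

lemma smooth_on_exp_primitive:
  fixes h \<omega> :: "real \<Rightarrow> real"
  assumes "smooth_on UNIV h" "\<And>r. (\<omega> has_real_derivative h r) (at r)"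
  shows "smooth_on UNIV (\<lambda>r. exp (c * \<omega> r))"
  unfolding smooth_on_def
proof
  fix k show "Ck_on k UNIV (\<lambda>r. exp (c * \<omega> r))"
  proof (induction k)
    case 0
    have "continuous_on UNIV \<omega>"
      using assms(2) DERIV_isCont by (blast intro: continuous_at_imp_continuous_on)
    then show ?case by (auto intro!: continuous_intros)
  next
    case (Suc k)
    have h: "Ck_on k UNIV h" using assms(1) by (simp add: smooth_on_def)
    show ?case
    proof (rule Ck_on_SucI)
      have "((\<lambda>r. exp (c * \<omega> r)) has_real_derivative (c * h r) * exp (c * \<omega> r)) (at r)" for r
        by (auto intro!: derivative_eq_intros assms(2))
      then show "((\<lambda>r. exp (c * \<omega> r)) has_derivative (*) ((c * h r) * exp (c * \<omega> r))) (at r)" for r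
        by (simp add: has_field_derivative_def)
      fix v
      have "Ck_on k UNIV (\<lambda>r. (v * c) *\<^sub>R h r *\<^sub>R exp (c * \<omega> r))"
        by (intro Ck_on_scaleR Ck_on_const h Suc open_UNIV)
      then show "Ck_on k UNIV (\<lambda>r. c * h r * exp (c * \<omega> r) * v)" by (simp add: mult_ac)
    qed simp
  qed
qed

section \<open>Primitives of periodic functions\<close>

lemma interval_integral_has_real_derivative:
  fixes h :: "real \<Rightarrow> real"
  assumes "continuous_on UNIV h"
  shows "((\<lambda>r. LBINT t=0..r. h t) has_real_derivative h r) (at r)"
proof -
  \<comment> \<open>The interval contains the base point 0 and has \<open>r\<close> in its interior,
    whatever the sign of \<open>r\<close>; hence the one-variable derivative within it is the full
    derivative.\<close>
  let ?a = "min 0 r - 1" and ?b = "max 0 r + 1"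
  have "((\<lambda>u. LBINT y=ereal 0..u. h y) has_vector_derivative h r) (at r within {?a..?b})"
    by (rule interval_integral_FTC2) (auto intro: continuous_on_subset[OF assms])
  moreover have "at r within {?a..?b} = at r"
    by (rule at_within_Icc_at) auto
  ultimately show ?thesis
    by (simp add: has_real_derivative_iff_has_vector_derivative zero_ereal_def)
qed

text \<open>The increment over one period has derivative \<open>h (r + p) - h r = 0\<close>, so it
  is constant, and it vanishes at 0.\<close>

lemma primitive_periodic:
  fixes h \<omega> :: "real \<Rightarrow> real"
  assumes "\<And>r. (\<omega> has_real_derivative h r) (at r)" "\<And>r. h (r + p) = h r" "\<omega> p = \<omega> 0"
  shows "\<omega> (r + p) = \<omega> r"
proof -
  have "((\<lambda>r. \<omega> (r + p) - \<omega> r) has_real_derivative 0) (at x)" for x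
    using DERIV_diff[OF DERIV_shift[THEN iffD1, OF assms(1)[of "x + p"]] assms(1)[of x]]
    by (simp add: assms(2))
  then have "\<omega> (r + p) - \<omega> r = \<omega> (0 + p) - \<omega> 0"
    by (rule DERIV_isconst_all[rule_format, of "\<lambda>r. \<omega> (r + p) - \<omega> r"]) 
  then show ?thesis using assms(3) by simp
qed

section \<open>Locality and linearity of the Dirac operator\<close>

lemma open_coord_dom:
  "closed_riemannian_spin_manifold N \<Longrightarrow> i \<in> chart_ix N \<Longrightarrow> open (coord_dom N i)"
  by (simp add: closed_riemannian_spin_manifold_def closed_manifold_def)

lemma matrix_vector_mult_scaleR_complex:
  "(A :: complex^'s^'t) *v (c *\<^sub>R v) = c *\<^sub>R (A *v v)"
  by (simp add: matrix_vector_mult_def vec_eq_iff scaleR_sum_right)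

lemma vector_scalar_mult_scaleR: "(z :: complex) *s (c *\<^sub>R v) = c *\<^sub>R (z *s v)"
  by (simp add: vec_eq_iff)

text \<open>At fixed \<open>r\<close> the radial factor of a separated spinor is such a constant
  \<open>c\<close>. Differentiability lets \<open>c\<close> pass through \<open>partial\<close>; the
  connection term is pointwise linear.\<close>

lemma dirac_scaleR:
  assumes "(\<psi> i) differentiable (at x)"
  shows "dirac N (\<lambda>i x. c *\<^sub>R \<psi> i x) i x = c *\<^sub>R dirac N \<psi> i x"
proof -
  have "partial k (\<lambda>y. c *\<^sub>R \<psi> i y) x = c *\<^sub>R partial k (\<psi> i) x" for k
    unfolding partial_def
    by (subst frechet_derivativeI[OF has_derivative_scaleR_right])
      (use assms frechet_derivative_works in auto)
  then have "spin_nabla N k (\<lambda>i x. c *\<^sub>R \<psi> i x) i x = c *\<^sub>R spin_nabla N k \<psi> i x" for k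
    by (simp add: spin_nabla_def matrix_vector_mult_scaleR_complex scaleR_sum_right
        scaleR_add_right mult_ac)
  then have "(\<Sum>k\<in>UNIV. frame N i x $ j $ k *\<^sub>R spin_nabla N k (\<lambda>i x. c *\<^sub>R \<psi> i x) i x) =
      c *\<^sub>R (\<Sum>k\<in>UNIV. frame N i x $ j $ k *\<^sub>R spin_nabla N k \<psi> i x)" for j
    by (simp add: scaleR_sum_right mult.commute)
  then show ?thesis
    by (simp add: dirac_def matrix_vector_mult_scaleR_complex vector_scalar_mult_scaleR
        flip: scaleR_sum_right)
qed

text \<open>Vanishing is known only on the coordinate domains, but these are open, so the partial
  derivatives vanish there too.\<close>

lemma dirac_zero_spinor:
  assumes "closed_riemannian_spin_manifold N" "zero_spinor N \<psi>"
  shows "zero_spinor N (dirac N \<psi>)"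
  unfolding zero_spinor_def
proof (intro ballI)
  fix i x assume ix: "i \<in> chart_ix N" "x \<in> coord_dom N i"
  have z: "\<psi> i y = 0" if "y \<in> coord_dom N i" for y
    using assms(2) ix(1) that by (simp add: zero_spinor_def)
  have "(\<psi> i has_derivative (\<lambda>v. 0)) (at x)"
    by (rule has_derivative_transform_within_open[OF has_derivative_const
          open_coord_dom[OF assms(1) ix(1)] ix(2)]) (simp add: z)
  then have "partial k (\<psi> i) x = 0" for k
    by (simp add: partial_def frechet_derivativeI)
  then show "dirac N \<psi> i x = 0"
    by (simp add: dirac_def spin_nabla_def z[OF ix(2)])
qed

text \<open>Every term of the adjoint operator is local in the chart, so it sends a spinor vanishing
  on all coordinate domains to another such spinor.\<close>

lemma hamiltonian_zero:
  assumes "closed_riemannian_spin_manifold N" "zero_spinorM N (dirac_deformed N f \<phi>)"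
  shows "zero_spinorM N (hamiltonian N f \<phi>)"
proof -
  obtain \<eta> \<zeta> where eq: "dirac_deformed N f \<phi> = (\<eta>, \<zeta>)" by fastforce
  have z: "zero_spinor N (\<eta> r)" "zero_spinor N (\<zeta> r)" for r
    using assms(2) by (auto simp: eq zero_spinorM_def)
  have "dr \<eta> r i x = 0" "dr \<zeta> r i x = 0" if "i \<in> chart_ix N" "x \<in> coord_dom N i" for r i x
    using z that by (simp_all add: dr_def zero_spinor_def)
  then show ?thesis
    using z dirac_zero_spinor[OF assms(1) z(1)] dirac_zero_spinor[OF assms(1) z(2)]
    by (simp add: hamiltonian_def eq dirac_deformed_adj_def diracM_def zero_spinorM_def
        zero_spinor_def)
qed

section \<open>Separated spinors on the product\<close>

lemma smooth_rspinor_scaleR: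
  assumes N: "closed_riemannian_spin_manifold N" and "smooth_spinor N \<psi>" and "smooth_circle_fun a"
  shows "smooth_rspinor N (\<lambda>r i x. a r *\<^sub>R \<psi> i x)"
  unfolding smooth_rspinor_def
proof (intro conjI allI ballI)
  show "compatible_spinor N (\<lambda>i x. a r *\<^sub>R \<psi> i x)" for r
    using assms(2) unfolding smooth_spinor_def compatible_spinor_def
    by (metis matrix_vector_mult_scaleR_complex)
  show "smooth_on (coord_dom N i \<times> UNIV) (\<lambda>(x, r). a r *\<^sub>R \<psi> i x)" if "i \<in> chart_ix N" for i
    using assms(2,3) that
    by (auto simp: smooth_spinor_def smooth_circle_fun_def
        intro!: smooth_on_scaleR_prod open_coord_dom[OF N])
  show "a (r + 2 * pi) *\<^sub>R \<psi> i x = a r *\<^sub>R \<psi> i x" for r i x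
    using assms(3) by (simp add: smooth_circle_fun_def)
qed

lemma dr_scaleR:
  assumes "(a has_real_derivative a') (at r)"
  shows "dr (\<lambda>r i x. a r *\<^sub>R \<psi> i x) r i x = a' *\<^sub>R \<psi> i x"
  unfolding dr_def
  by (rule vector_derivative_at)
    (use has_vector_derivative_scaleR[OF assms has_vector_derivative_const] in simp)

text \<open>The two signs \<open>s = \<plusminus>1\<close> give \<open>\<phi>\<^sub>1\<close> and \<open>\<phi>\<^sub>2\<close>.\<close>

lemma hamiltonian_zero_mode_separated:
  fixes s :: real
  assumes N: "closed_riemannian_spin_manifold N" and \<psi>: "dirac_zero_mode N \<psi>"
    and a: "smooth_circle_fun a" "\<And>r. a r \<noteq> 0"
    and da: "\<And>r. (a has_real_derivative - s * f r * a r) (at r)" and s: "s * s = 1"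
  shows "hamiltonian_zero_mode N f
    ((\<lambda>r i x. a r *\<^sub>R \<psi> i x), (\<lambda>r i x. (s * a r) *\<^sub>R \<psi> i x))" (is "hamiltonian_zero_mode N f ?\<phi>")
proof -
  have sm: "smooth_spinor N \<psi>" and nz: "\<not> zero_spinor N \<psi>" and D0: "zero_spinor N (dirac N \<psi>)"
    using \<psi> by (auto simp: dirac_zero_mode_def)
  have sa: "smooth_circle_fun (\<lambda>r. s * a r)"
    using a(1) Ck_on_scaleR[OF open_UNIV Ck_on_const[of _ _ s], of _ a]
    by (simp add: smooth_circle_fun_def smooth_on_def)
  \<comment> \<open>Since \<open>s * s = 1\<close>, the factor \<open>s\<close> moves from the
    derivative of the upper component to the value of the lower one.\<close>
  have dsa: "((\<lambda>r. s * a r) has_real_derivative - f r * a r) (at r)" for r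
    using DERIV_cmult[OF da[of r], of s] by (simp add: s mult.assoc[symmetric])
  have D: "dirac N (\<lambda>i x. c *\<^sub>R \<psi> i x) i x = 0" if "i \<in> chart_ix N" "x \<in> coord_dom N i" for c i x
  proof -
    have "\<psi> i differentiable (at x)"
      using sm that smooth_on_has_derivative[of "coord_dom N i" "\<psi> i" x]
      by (auto simp: smooth_spinor_def differentiable_def)
    from dirac_scaleR[of \<psi> i x N c, OF this] show ?thesis using D0 that by (simp add: zero_spinor_def)
  qed
  \<comment> \<open>The terms with the Dirac operator of \<open>N\<close> drop out. What remains is
    \<open>\<i>\<close> times \<open>(s * a)' + f * a\<close> above and
    \<open>a' + f * s * a\<close> below, and both sums cancel.\<close>
  have "zero_spinorM N (dirac_deformed N f ?\<phi>)"
    unfolding zero_spinorM_def zero_spinor_def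
    by (auto simp: dirac_deformed_def diracM_def D dr_scaleR[OF da] dr_scaleR[OF dsa] vec_eq_iff
        scaleR_conv_of_real[where 'a = complex])
  moreover have "smooth_spinorM N ?\<phi>"
    using smooth_rspinor_scaleR[OF N sm] a(1) sa by (simp add: smooth_spinorM_def)
  moreover have "\<not> zero_spinorM N ?\<phi>"
    using nz a(2) by (auto simp: zero_spinorM_def zero_spinor_def)
  ultimately show ?thesis
    using hamiltonian_zero[OF N] by (simp add: hamiltonian_zero_mode_def)
qed

section \<open>Norms of separated spinors\<close>

lemma pnorm_scaleR: "pnorm N (\<lambda>i x. c *\<^sub>R \<psi> i x) p = \<bar>c\<bar> * pnorm N \<psi> p"
  by (simp add: pnorm_def Let_def)

lemma L2norm_squared: "(L2norm N \<psi>)\<^sup>2 = (LINT p|dvol N. (pnorm N \<psi> p)\<^sup>2)"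
  by (simp add: L2norm_def)

lemma L2normM_separated:
  "(L2normM N ((\<lambda>r i x. a r *\<^sub>R \<psi> i x), (\<lambda>r i x. b r *\<^sub>R \<psi> i x)))\<^sup>2 =
    (LBINT r=0..2 * pi. (a r)\<^sup>2 + (b r)\<^sup>2) * (L2norm N \<psi>)\<^sup>2"
proof -
  let ?I = "LBINT r=0..2 * pi. (a r)\<^sup>2 + (b r)\<^sup>2"
  have "(LBINT r=0..2 * pi. (pnorm N (\<lambda>i x. a r *\<^sub>R \<psi> i x) p)\<^sup>2 + (pnorm N (\<lambda>i x. b r *\<^sub>R \<psi> i x) p)\<^sup>2)
      = ?I * (pnorm N \<psi> p)\<^sup>2" for p
    by (simp add: pnorm_scaleR power_mult_distrib flip: distrib_right)
  \<comment> \<open>Together with the nonnegative integral over \<open>N\<close>, this lets squaring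
    undo the square root in \<open>L2normM\<close>.\<close>
  moreover have "0 \<le> ?I"
    by (auto simp: interval_lebesgue_integral_def set_lebesgue_integral_def intro!: integral_nonneg)
  ultimately show ?thesis
    by (simp add: L2normM_def L2norm_squared)
qed

theorem proposition7:
  fixes N :: "('i, 'p, 'd::finite, 's::finite) spin_data"
    and n m :: nat
    and f h \<omega> :: "real \<Rightarrow> real"
    and \<tau> A\<^sub>1 A\<^sub>2 :: real
    and \<psi>\<^sub>0 :: "('i, 'd, 's) spinor"
    and \<phi>\<^sub>1 \<phi>\<^sub>2 :: "('i, 'd, 's) spinorM"
  assumes "n = 2 * m"
    and "CARD('d) = n - 1"
    and "CARD('s) = 2 ^ (m - 1)"
    and "closed_riemannian_spin_manifold N"
    and "smooth_circle_fun f"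
    and "(LBINT t=0..2 * pi. f t) = 0"
    and "\<tau> > 0"
    and "f = (\<lambda>r. \<tau> * h r)"
    and "smooth_circle_fun h"
    and "(LBINT r=0..2 * pi. h r) = 0"
    and "(LBINT r=0..2 * pi. \<bar>h r\<bar>\<^sup>2) = 1 / vol N"
    and "\<omega> = (\<lambda>r. LBINT t=0..r. h t)"
    and "dirac_zero_mode N \<psi>\<^sub>0"
    and "\<phi>\<^sub>1 = ((\<lambda>r i x. exp (- \<tau> * \<omega> r) *\<^sub>R \<psi>\<^sub>0 i x), (\<lambda>r i x. exp (- \<tau> * \<omega> r) *\<^sub>R \<psi>\<^sub>0 i x))"
    and "\<phi>\<^sub>2 = ((\<lambda>r i x. exp (\<tau> * \<omega> r) *\<^sub>R \<psi>\<^sub>0 i x), (\<lambda>r i x. exp (\<tau> * \<omega> r) *\<^sub>R (- \<psi>\<^sub>0 i x)))"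
    and "A\<^sub>1 = 2 * (LBINT r=0..2 * pi. exp (- 2 * \<tau> * \<omega> r))"
    and "A\<^sub>2 = 2 * (LBINT r=0..2 * pi. exp (2 * \<tau> * \<omega> r))"
  shows "hamiltonian_zero_mode N f \<phi>\<^sub>1 \<and> hamiltonian_zero_mode N f \<phi>\<^sub>2
    \<and> (L2normM N \<phi>\<^sub>1)\<^sup>2 = A\<^sub>1 * (L2norm N \<psi>\<^sub>0)\<^sup>2
    \<and> (L2normM N \<phi>\<^sub>2)\<^sup>2 = A\<^sub>2 * (L2norm N \<psi>\<^sub>0)\<^sup>2"
proof -
  note N = assms(4)
  have h: "smooth_on UNIV h" "\<And>r. h (r + 2 * pi) = h r"
    using assms(9) by (auto simp: smooth_circle_fun_def)
  have d\<omega>: "(\<omega> has_real_derivative h r) (at r)" for r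
    unfolding assms(12) by (rule interval_integral_has_real_derivative[OF smooth_on_imp_continuous_on[OF h(1)]])
  \<comment> \<open>The zero average of \<open>h\<close> enters here; it is what makes the
    exponentials functions on the circle.\<close>
  have "\<omega> (2 * pi) = \<omega> 0"
    using assms(10) by (simp add: assms(12) zero_ereal_def[symmetric])
  then have per: "\<omega> (r + 2 * pi) = \<omega> r" for r
    by (rule primitive_periodic[where h = h and p = "2 * pi", OF d\<omega> h(2)])
  have sm: "smooth_circle_fun (\<lambda>r. exp (c * \<omega> r))" for c
    using smooth_on_exp_primitive[OF h(1) d\<omega>] by (simp add: smooth_circle_fun_def per)
  have de: "((\<lambda>r. exp (c * \<omega> r)) has_real_derivative c * h r * exp (c * \<omega> r)) (at r)" for c r
    by (auto intro!: derivative_eq_intros d\<omega>)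
  have sq: "(exp (c * \<omega> r))\<^sup>2 = exp (2 * c * \<omega> r)" for c r
    by (simp add: power2_eq_square flip: exp_add)
  \<comment> \<open>Both spinors are put into the separated form, with \<open>s = 1\<close> here and
    \<open>s = - 1\<close> for the second.\<close>
  have \<phi>1: "\<phi>\<^sub>1 = ((\<lambda>r i x. exp (- \<tau> * \<omega> r) *\<^sub>R \<psi>\<^sub>0 i x), (\<lambda>r i x. (1 * exp (- \<tau> * \<omega> r)) *\<^sub>R \<psi>\<^sub>0 i x))"
    by (simp add: assms(14))
  have \<phi>2: "\<phi>\<^sub>2 = ((\<lambda>r i x. exp (\<tau> * \<omega> r) *\<^sub>R \<psi>\<^sub>0 i x), (\<lambda>r i x. (- 1 * exp (\<tau> * \<omega> r)) *\<^sub>R \<psi>\<^sub>0 i x))"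
    by (simp add: assms(15))
  have "hamiltonian_zero_mode N f \<phi>\<^sub>1"
    unfolding \<phi>1
    by (rule hamiltonian_zero_mode_separated[OF N assms(13) sm]) (use de[of "- \<tau>"] in \<open>simp_all add: assms(8)\<close>)
  moreover have "hamiltonian_zero_mode N f \<phi>\<^sub>2"
    unfolding \<phi>2
    by (rule hamiltonian_zero_mode_separated[OF N assms(13) sm]) (use de[of \<tau>] in \<open>simp_all add: assms(8)\<close>)
  \<comment> \<open>The two components have equal squared radial factors, whose sum produces the
    factor 2 in \<open>A\<^sub>1\<close>; the same happens for \<open>A\<^sub>2\<close>.\<close>
  moreover have "(L2normM N \<phi>\<^sub>1)\<^sup>2 = A\<^sub>1 * (L2norm N \<psi>\<^sub>0)\<^sup>2"
    unfolding \<phi>1 L2normM_separated using sq[of "- \<tau>"] by (simp add: assms(16) flip: mult_2)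
  moreover have "(L2normM N \<phi>\<^sub>2)\<^sup>2 = A\<^sub>2 * (L2norm N \<psi>\<^sub>0)\<^sup>2"
    unfolding \<phi>2 L2normM_separated using sq[of \<tau>] by (simp add: assms(17) flip: mult_2)
  ultimately show ?thesis by blast
qed

end
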